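(* Let $G$ be a finite simple graph. Then $G$ is $P_3$-connected if and only if $G$ is connected and has no non-stable homogeneous set.
   Context: All graphs are finite and simple. $P_n$ denotes the path with exactly $n$ vertices; an induced $P_3$ in $G$ is given by three distinct vertices $a,b,c$ with $ab,bc\in E(G)$ and $ac\notin E(G)$, and its two edges are $ab$ and $bc$. For edges $e,f$ of $G$, $e$ and $f$ are $P_3$-connected in $G$ if there exists a sequence of edges $e=e_0,e_1,\ldots,e_k=f$ of $G$ such that $e_i$ and $e_{i+1}$ are the two edges of an induced $P_3$ in $G$ for every $0\le i\le k-1$. The graph $G$ is $P_3$-connected if every pair of edges of $G$ are $P_3$-connected in $G$. For $X\subseteq V(G)$, $G[X]$ denotes the subgraph of $G$ induced by $X$. A set $X\subseteq V(G)$ is stable if $G[X]$ contains no edge, and non-stable otherwise. A set $X\subseteq V(G)$ is a homogeneous set of $G$ if $2\le |X|<|V(G)|$ and for every vertex $y\in V(G)\setminus X$, either $X\subseteq N(y)$ or $X\cap N(y)=\emptyset$, where $N(y)$ is the set of neighbours of $y$.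
   Formalization: The graph is assumed to be non-empty and, if it has at least two vertices, to have no isolated vertex; without this the claim fails, e.g. one edge plus an isolated vertex is P_3-connected but not connected. *)

theory Defs
  imports "Graph_Theory.Digraph_Component"
begin

text \<open>
  A finite simple graph is a \<^term>\<open>graph\<close> of Graph_Theory, i.e. a finite symmetric digraph
  without loops and parallel arcs.  An undirected edge is a pair of opposite arcs there; as the
  edges themselves are chained below, they are made into unordered pairs of vertices.
\<close>

definition edges :: "('a, 'b) pre_digraph \<Rightarrow> 'a set set" where
  "edges G = {{u, v} | u v. u \<rightarrow>\<^bsub>G\<^esub> v}"

definition neighbours :: "('a, 'b) pre_digraph \<Rightarrow> 'a \<Rightarrow> 'a set" where
  "neighbours G y = {x. y \<rightarrow>\<^bsub>G\<^esub> x}"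

definition induced_P3 :: "('a, 'b) pre_digraph \<Rightarrow> 'a \<Rightarrow> 'a \<Rightarrow> 'a \<Rightarrow> bool" where
  "induced_P3 G a b c \<longleftrightarrow>
     distinct [a, b, c] \<and> {a, b} \<in> edges G \<and> {b, c} \<in> edges G \<and> {a, c} \<notin> edges G"

definition edges_of_induced_P3 :: "('a, 'b) pre_digraph \<Rightarrow> 'a set \<Rightarrow> 'a set \<Rightarrow> bool" where
  "edges_of_induced_P3 G e f \<longleftrightarrow>
     (\<exists>a b c. induced_P3 G a b c \<and> {e, f} = {{a, b}, {b, c}})"

definition P3_connected_edges :: "('a, 'b) pre_digraph \<Rightarrow> 'a set \<Rightarrow> 'a set \<Rightarrow> bool" where
  "P3_connected_edges G e f \<longleftrightarrow>
     (\<exists>(k :: nat) s. s 0 = e \<and> s k = f \<and> (\<forall>i\<le>k. s i \<in> edges G) \<and>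
        (\<forall>i<k. edges_of_induced_P3 G (s i) (s (Suc i))))"

text \<open>
  This ignores isolated vertices: an edge together with an isolated vertex is
  P3-connected, but not connected.  The equivalence with connectedness and the absence of
  non-stable homogeneous sets therefore needs graphs with at least two vertices to have no
  isolated vertex.
\<close>

definition P3_connected :: "('a, 'b) pre_digraph \<Rightarrow> bool" where
  "P3_connected G \<longleftrightarrow> (\<forall>e\<in>edges G. \<forall>f\<in>edges G. P3_connected_edges G e f)"

definition stable_set :: "('a, 'b) pre_digraph \<Rightarrow> 'a set \<Rightarrow> bool" where
  "stable_set G X \<longleftrightarrow> edges (G \<restriction> X) = {}"

definition homogeneous_set :: "('a, 'b) pre_digraph \<Rightarrow> 'a set \<Rightarrow> bool" where
  "homogeneous_set G X \<longleftrightarrow>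
     X \<subseteq> verts G \<and> 2 \<le> card X \<and> card X < card (verts G) \<and>
     (\<forall>y\<in>verts G - X. X \<subseteq> neighbours G y \<or> X \<inter> neighbours G y = {})"

end

theory Submission
  imports Defs
begin

text \<open>
  Call two edges linked if they lie in the same class of the equivalence relation generated by
  being the two edges of an induced \<open>P\<^sub>3\<close>.

  Suppose that all edges are linked.  Consecutive edges of a chain share a vertex, so a chain
  traces a connected subgraph; since two distinct vertices are never isolated, each is reached from
  the other.  Moreover, a chain that starts inside a homogeneous set stays there (lemma \<open>linked_inside_homogeneous_set\<close>), because the
  two ends of an edge inside the set have the same neighbours outside.  A non-stable homogeneous set
  would contain an edge, and a vertex outside of it would again lie on an edge, which could not be
  linked to the first.

  For the converse, two facts about the set \<open>X\<close> of vertices covered by one class are combined.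
  A vertex outside \<open>X\<close> that is adjacent to one vertex of \<open>X\<close> is adjacent to all of them (lemma
  \<open>uncovered_adjacent_to_all\<close>); so in the absence of non-stable homogeneous sets, every class
  covers all vertices.  On the other hand, if a triangle has exactly one edge in a class, then its
  third vertex is not covered by that class (lemma \<open>triangle_apex_not_covered\<close>).  Hence every class
  that meets a triangle contains at least two of its three edges, and all classes meeting the same
  triangle coincide.  Therefore two edges \<open>ab\<close> and \<open>bc\<close> are linked whether \<open>ac\<close> is an edge or
  not, and connectedness carries this over to any two edges.
\<close>

context graph
begin

section \<open>Edges and chains of induced paths\<close>

lemma adj_sym: "u \<rightarrow> v \<longleftrightarrow> v \<rightarrow> u"
  using arcs_ends_symmetric[OF sym_arcs] by auto

lemma not_adj_self [simp]: "\<not> v \<rightarrow> v"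
  using adj_not_same by blast

lemma doubleton_in_edges_iff [simp]: "{u, v} \<in> edges G \<longleftrightarrow> u \<rightarrow> v"
  unfolding edges_def using adj_sym by (auto simp: doubleton_eq_iff)

lemma edgesE:
  assumes "e \<in> edges G"
  obtains u v where "e = {u, v}" "u \<rightarrow> v"
  using assms unfolding edges_def by blast

lemma induced_P3_iff: "induced_P3 G a b c \<longleftrightarrow> a \<noteq> c \<and> a \<rightarrow> b \<and> b \<rightarrow> c \<and> \<not> a \<rightarrow> c"
  unfolding induced_P3_def by auto

lemma edges_of_induced_P3I:
  assumes "a \<rightarrow> b" "b \<rightarrow> c" "a \<noteq> c" "\<not> a \<rightarrow> c"
  shows "edges_of_induced_P3 G {a, b} {b, c}"
  using assms unfolding edges_of_induced_P3_def induced_P3_iff by blast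

lemma edges_of_induced_P3E:
  assumes "edges_of_induced_P3 G e f"
  obtains a b c where "e = {a, b}" "f = {b, c}" "a \<rightarrow> b" "b \<rightarrow> c" "a \<noteq> c" "\<not> a \<rightarrow> c"
proof -
  from assms obtain a b c where P: "induced_P3 G a b c" and ef: "{e, f} = {{a, b}, {b, c}}"
    unfolding edges_of_induced_P3_def by blast
  from ef consider "e = {a, b}" "f = {b, c}" | "e = {c, b}" "f = {b, a}"
    by (auto simp: doubleton_eq_iff insert_commute)
  then show ?thesis
    using P that adj_sym unfolding induced_P3_iff by cases metis+
qed

abbreviation linked :: "'a set \<Rightarrow> 'a set \<Rightarrow> bool" where
  "linked \<equiv> (edges_of_induced_P3 G)\<^sup>*\<^sup>*"

lemma linked_sym: "linked e f \<Longrightarrow> linked f e"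
proof -
  have "symp (edges_of_induced_P3 G)"
    unfolding symp_def edges_of_induced_P3_def by (metis insert_commute)
  then show "linked e f \<Longrightarrow> linked f e"
    using sympD symp_rtranclp by metis
qed

lemma linked_in_edges:
  assumes "linked e f" "e \<in> edges G"
  shows "f \<in> edges G"
  using assms by induction (auto elim: edges_of_induced_P3E)

lemma P3_connected_edges_iff_linked:
  assumes "e \<in> edges G"
  shows "P3_connected_edges G e f \<longleftrightarrow> linked e f"
proof
  assume "P3_connected_edges G e f"
  then show "linked e f"
    unfolding P3_connected_edges_def by (metis relpowp_fun_conv rtranclp_power)
next
  assume "linked e f"
  then obtain k s where s: "s 0 = e" "s k = f"
      "\<forall>i<k. edges_of_induced_P3 G (s i) (s (Suc i))"
    by (metis relpowp_fun_conv rtranclp_power)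
  have "s i \<in> edges G" if "i \<le> k" for i
    using that
  proof (induction i)
    case 0
    then show ?case using s assms by simp
  next
    case (Suc i)
    then show ?case using s(3) linked_in_edges
      by (meson Suc_leD Suc_le_lessD r_into_rtranclp)
  qed
  then show "P3_connected_edges G e f"
    unfolding P3_connected_edges_def by (intro exI[of _ k] exI[of _ s]) (simp add: s)
qed

lemma P3_connected_iff_linked:
  "P3_connected G \<longleftrightarrow> (\<forall>e\<in>edges G. \<forall>f\<in>edges G. linked e f)"
  by (simp add: P3_connected_def P3_connected_edges_iff_linked)

lemma stable_set_iff: "stable_set G X \<longleftrightarrow> (\<forall>u\<in>X. \<forall>v\<in>X. \<not> u \<rightarrow> v)"
proof -
  have "u \<rightarrow>\<^bsub>G \<restriction> X\<^esub> v \<longleftrightarrow> u \<in> X \<and> v \<in> X \<and> u \<rightarrow> v" for u v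
    unfolding arcs_ends_conv by auto
  then show ?thesis
    by (auto simp: stable_set_def edges_def)
qed

lemma connected_iff_reachable:
  "connected G \<longleftrightarrow> verts G \<noteq> {} \<and> (\<forall>u\<in>verts G. \<forall>v\<in>verts G. u \<rightarrow>\<^sup>* v)"
  by (simp add: connected_def strongly_connected_def reachable_mk_symmetric_eq[OF sym_arcs])

section \<open>Consequences of being \<open>P\<^sub>3\<close>-connected\<close>

lemma linked_reachable:
  assumes "linked e f" "\<forall>x\<in>e. u \<rightarrow>\<^sup>* x"
  shows "\<forall>x\<in>f. u \<rightarrow>\<^sup>* x"
  using assms
proof induction
  case (step f g)
  then show ?case
    by (metis edges_of_induced_P3E insert_iff reachable_adj_trans singletonD)
qed auto

text \<open>
  If an induced path \<open>abc\<close> started with an edge \<open>ab\<close> inside a homogeneous set and \<open>c\<close> were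
  outside, then \<open>c\<close> would be adjacent to \<open>a\<close> because it is adjacent to \<open>b\<close>.
\<close>
lemma linked_inside_homogeneous_set:
  assumes X: "homogeneous_set G X" and "linked e f" "e \<subseteq> X"
  shows "f \<subseteq> X"
  using assms(2,3)
proof induction
  case (step f g)
  then obtain a b c where abc: "f = {a, b}" "g = {b, c}" "b \<rightarrow> c" "\<not> a \<rightarrow> c"
    by (metis edges_of_induced_P3E)
  have "c \<in> X"
  proof (rule ccontr)
    assume "c \<notin> X"
    then have "c \<in> verts G - X" using adj_in_verts abc(3) by blast
    then have "X \<subseteq> neighbours G c \<or> X \<inter> neighbours G c = {}"
      using X unfolding homogeneous_set_def by blast
    then show False
      using step abc adj_sym unfolding neighbours_def by blast
  qed
  then show ?case using step abc by simp
qed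

section \<open>The vertices covered by a class of linked edges\<close>

definition covered :: "'a set \<Rightarrow> 'a set" where
  "covered e = {x. \<exists>f. linked e f \<and> x \<in> f}"

lemma coveredI: "linked e f \<Longrightarrow> x \<in> f \<Longrightarrow> x \<in> covered e"
  unfolding covered_def by blast

text \<open>
  If \<open>y\<close> were adjacent to just one end \<open>b\<close> of an edge \<open>bc\<close> of the class, then \<open>ybc\<close> would be an
  induced path, so that \<open>yb\<close> would be in the class and cover \<open>y\<close>.  Consecutive edges of a chain
  share a vertex, so complete adjacency to \<open>y\<close> passes along the chain.
\<close>
lemma uncovered_adjacent_to_all:
  assumes e: "e \<in> edges G" and y: "y \<notin> covered e" and a: "a \<in> covered e" "y \<rightarrow> a"
    and x: "x \<in> covered e"
  shows "y \<rightarrow> x"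
proof -
  have both: "\<forall>x\<in>f. y \<rightarrow> x" if f: "linked e f" "b \<in> f" "y \<rightarrow> b" for f b
  proof
    fix x assume "x \<in> f"
    obtain u v where "f = {u, v}" "u \<rightarrow> v"
      using linked_in_edges[OF f(1) e] by (rule edgesE)
    with f(2) obtain c where c: "f = {b, c}" "b \<rightarrow> c"
      using adj_sym by (metis insert_commute insert_iff singletonD)
    have "y \<rightarrow> c"
    proof (rule ccontr)
      assume "\<not> y \<rightarrow> c"
      moreover have "y \<noteq> c" using y f(1) c(1) coveredI by blast
      ultimately have "edges_of_induced_P3 G {y, b} f"
        using edges_of_induced_P3I f(3) c by metis
      then have "linked e {y, b}"
        using f(1) linked_sym by (meson r_into_rtranclp rtranclp_trans)
      then show False using y coveredI by blast
    qed
    then show "y \<rightarrow> x" using \<open>x \<in> f\<close> c f(3) by blast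
  qed
  obtain f where f: "linked e f" "a \<in> f" using a(1) unfolding covered_def by blast
  obtain g where g: "linked e g" "x \<in> g" using x unfolding covered_def by blast
  have "linked f g" using f g linked_sym by (meson rtranclp_trans)
  then have "\<forall>x\<in>g. y \<rightarrow> x"
  proof induction
    case base
    then show ?case using both f a(2) by blast
  next
    case (step g h)
    then have "linked e h" using f(1) by (meson rtranclp.rtrancl_into_rtrancl rtranclp_trans)
    then show ?case using step both by (metis edges_of_induced_P3E insertI1 insertI2)
  qed
  then show ?thesis using g by blast
qed

lemma covered_eq_verts:
  assumes e: "e \<in> edges G"
    and none: "\<not> (\<exists>X. homogeneous_set G X \<and> \<not> stable_set G X)"
  shows "covered e = verts G"
proof (rule ccontr)
  assume neq: "covered e \<noteq> verts G"
  obtain u v where uv: "e = {u, v}" "u \<rightarrow> v" using e by (rule edgesE)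
  have sub: "covered e \<subseteq> verts G"
  proof
    fix x assume "x \<in> covered e"
    then obtain f where "linked e f" "x \<in> f" unfolding covered_def by blast
    then show "x \<in> verts G"
      using linked_in_edges[OF _ e] adj_in_verts by (metis edgesE insert_iff singletonD)
  qed
  have e_sub: "{u, v} \<subseteq> covered e" using uv(1) coveredI by blast
  have "u \<noteq> v" using uv(2) by auto
  then have "2 \<le> card (covered e)"
    using card_mono[OF finite_subset[OF sub finite_verts] e_sub] by simp
  moreover have "card (covered e) < card (verts G)"
    using sub neq by (simp add: psubset_card_mono psubset_eq)
  moreover have "covered e \<subseteq> neighbours G y \<or> covered e \<inter> neighbours G y = {}"
    if "y \<notin> covered e" for y
    using uncovered_adjacent_to_all[OF e that] unfolding neighbours_def by blast
  ultimately have "homogeneous_set G (covered e)"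
    using sub unfolding homogeneous_set_def by blast
  moreover have "\<not> stable_set G (covered e)"
    using e_sub uv(2) unfolding stable_set_iff by blast
  ultimately show False using none by blast
qed

section \<open>Triangles\<close>

text \<open>
  A chain through the class of \<open>bc\<close> keeps \<open>a\<close> as the apex of a triangle whose other two edges lie
  outside of the class.  Let the chain pass from \<open>xy\<close> to \<open>yz\<close>.  If \<open>az\<close> were not an edge,
  then \<open>ayz\<close> would be an induced path and \<open>ay\<close> would be linked to \<open>yz\<close>.  As \<open>xz\<close> is not an edge,
  \<open>zax\<close> is an induced path, so \<open>az\<close> is outside of the class because \<open>ax\<close> is.
\<close>
lemma triangle_apex_not_covered:
  assumes bc: "b \<rightarrow> c" and ab: "a \<rightarrow> b" "\<not> linked {b, c} {a, b}"
    and ac: "a \<rightarrow> c" "\<not> linked {b, c} {a, c}"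
  shows "a \<notin> covered {b, c}"
proof -
  have apex: "\<forall>x\<in>f. a \<rightarrow> x \<and> \<not> linked {b, c} {a, x}" if "linked {b, c} f" for f
    using that
  proof induction
    case base
    then show ?case using ab ac by blast
  next
    case (step f g)
    obtain x y z where xyz: "f = {x, y}" "g = {y, z}" "x \<rightarrow> y" "y \<rightarrow> z" "x \<noteq> z" "\<not> x \<rightarrow> z"
      using step(2) by (rule edges_of_induced_P3E)
    have x: "a \<rightarrow> x" "\<not> linked {b, c} {a, x}" and y: "a \<rightarrow> y" "\<not> linked {b, c} {a, y}"
      using step xyz by auto
    have g: "linked {b, c} {y, z}" using step xyz by (meson rtranclp.rtrancl_into_rtrancl)
    have "a \<noteq> z" using x xyz adj_sym by blast
    have az: "a \<rightarrow> z"
    proof (rule ccontr)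
      assume "\<not> a \<rightarrow> z"
      then have "edges_of_induced_P3 G {a, y} {y, z}"
        using edges_of_induced_P3I y xyz \<open>a \<noteq> z\<close> by blast
      then show False using g y linked_sym by (meson r_into_rtranclp rtranclp_trans)
    qed
    have "edges_of_induced_P3 G {z, a} {a, x}"
      using edges_of_induced_P3I az x xyz adj_sym by metis
    then have "\<not> linked {b, c} {a, z}"
      using x by (metis insert_commute rtranclp.rtrancl_into_rtrancl)
    then show ?case using az y xyz by blast
  qed
  show ?thesis
  proof
    assume "a \<in> covered {b, c}"
    then obtain f where "linked {b, c} f" "a \<in> f" unfolding covered_def by blast
    then have "a \<rightarrow> a" using apex by blast
    then show False by simp
  qed
qed

text \<open>
  If the edges \<open>ab\<close> and \<open>bc\<close> were not linked, they would form a triangle with \<open>ac\<close>.  The class of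
  each covers all vertices, including the opposite vertex of the triangle, and so contains
  a second edge of the triangle.  For both classes this can only be \<open>ac\<close>.
\<close>
lemma adjacent_edges_linked:
  assumes none: "\<not> (\<exists>X. homogeneous_set G X \<and> \<not> stable_set G X)"
    and ab: "a \<rightarrow> b" and bc: "b \<rightarrow> c"
  shows "linked {a, b} {b, c}"
proof (rule ccontr)
  assume not_linked: "\<not> linked {a, b} {b, c}"
  then have "a \<noteq> c" by (auto simp: insert_commute)
  then have ac: "a \<rightarrow> c"
    using not_linked edges_of_induced_P3I ab bc by (metis r_into_rtranclp)
  have "c \<in> covered {a, b}" "a \<in> covered {b, c}"
    using covered_eq_verts[OF _ none] ab bc adj_in_verts by auto
  then have "linked {a, b} {a, c}" "linked {b, c} {a, c}"
    using triangle_apex_not_covered[of a b c] triangle_apex_not_covered[of b c a]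
      not_linked linked_sym ab bc ac adj_sym by (metis insert_commute)+
  then show False using not_linked linked_sym by (meson rtranclp_trans)
qed

lemma P3_connected_if_no_homogeneous:
  assumes none: "\<not> (\<exists>X. homogeneous_set G X \<and> \<not> stable_set G X)"
    and con: "connected G"
  shows "P3_connected G"
  unfolding P3_connected_iff_linked
proof (intro ballI)
  fix e f assume "e \<in> edges G" "f \<in> edges G"
  then obtain u v w x where uv: "e = {u, v}" "u \<rightarrow> v" and wx: "f = {w, x}" "w \<rightarrow> x"
    by (metis edgesE)
  have "u \<rightarrow>\<^sup>* w"
    using con uv wx adj_in_verts unfolding connected_iff_reachable by blast
  then have "\<forall>x. w \<rightarrow> x \<longrightarrow> linked e {w, x}"
  proof (induction rule: reachable_induct)
    case base
    then show ?case
      using adjacent_edges_linked[OF none, of v u] uv adj_sym by (metis insert_commute)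
  next
    case (step w z)
    then show ?case
      using adjacent_edges_linked[OF none, of w z] by (meson rtranclp_trans)
  qed
  then show "linked e f" using wx by blast
qed

end

theorem theorem1p1:
  fixes G :: "('a, 'b) pre_digraph"
  assumes "graph G"
    and "verts G \<noteq> {}"
    and "2 \<le> card (verts G) \<longrightarrow> (\<forall>v\<in>verts G. neighbours G v \<noteq> {})"
  shows "P3_connected G \<longleftrightarrow>
    connected G \<and> \<not> (\<exists>X. homogeneous_set G X \<and> \<not> stable_set G X)"
proof -
  interpret graph G by fact
  have nbr: "\<exists>w. v \<rightarrow>\<^bsub>G\<^esub> w" if "v \<in> verts G" "u \<in> verts G" "u \<noteq> v" for u v
  proof -
    have "2 \<le> card (verts G)"
      using that card_mono[OF finite_verts, of "{u, v}"] by simp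
    then show ?thesis using assms(3) that(1) unfolding neighbours_def by blast
  qed
  show ?thesis
  proof
    assume "P3_connected G"
    then have linked: "linked e f" if "e \<in> edges G" "f \<in> edges G" for e f
      using that P3_connected_iff_linked by blast
    have "u \<rightarrow>\<^sup>*\<^bsub>G\<^esub> v" if uv: "u \<in> verts G" "v \<in> verts G" for u v
    proof (cases "u = v")
      case False
      then obtain u' v' where adj: "u \<rightarrow>\<^bsub>G\<^esub> u'" "v \<rightarrow>\<^bsub>G\<^esub> v'"
        using nbr uv by metis
      have "linked {u, u'} {v, v'}" using linked adj by simp
      moreover have "\<forall>x\<in>{u, u'}. u \<rightarrow>\<^sup>*\<^bsub>G\<^esub> x" using adj uv by auto
      ultimately show ?thesis using linked_reachable by blast
    qed (use uv in auto)
    then have "connected G"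
      using assms(2) unfolding connected_iff_reachable by blast
    moreover have "stable_set G X" if X: "homogeneous_set G X" for X
    proof (rule ccontr)
      assume "\<not> stable_set G X"
      then obtain u v where uv: "u \<in> X" "v \<in> X" "u \<rightarrow>\<^bsub>G\<^esub> v" unfolding stable_set_iff by blast
      have "X \<subset> verts G" using X unfolding homogeneous_set_def by auto
      then obtain y where y: "y \<in> verts G" "y \<notin> X" by blast
      then obtain z where "y \<rightarrow>\<^bsub>G\<^esub> z" using nbr uv adj_in_verts by metis
      then have "linked {u, v} {y, z}" using linked uv by simp
      then have "{y, z} \<subseteq> X" using linked_inside_homogeneous_set[OF X] uv by blast
      then show False using y by blast
    qed
    ultimately show "connected G \<and> \<not> (\<exists>X. homogeneous_set G X \<and> \<not> stable_set G X)"
      by blast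
  next
    assume "connected G \<and> \<not> (\<exists>X. homogeneous_set G X \<and> \<not> stable_set G X)"
    then show "P3_connected G" using P3_connected_if_no_homogeneous by blast
  qed
qed

end
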